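(* Let $N\ge 1$, let $f_1,\dots,f_N:\mathbb{R}\to\mathbb{R}$ be convex functions, let $X_1,\dots,X_N\subseteq\mathbb{R}$ be closed convex sets such that $\mathrm{int}\,X=\bigcap_{i=1}^N\mathrm{int}\,X_i$ is nonempty, where $X=\bigcap_{i=1}^N X_i$, let $f(x)=\sum_{i=1}^N f_i(x)$, and assume that $f^*=\min_{x\in X}f(x)$ is finite and $\mathcal{X}^*=\{x\in X: f(x)=f^*\}$ is nonempty. Let $\mathcal{G}$ be a connected weighted undirected graph on $\{1,\dots,N\}$ with Laplacian $L$ and diameter $\mathrm{D}(\mathcal{G})$, let $D\ge\mathrm{D}(\mathcal{G})+1$ be an integer, and let $c>0$. Let $\alpha_k,\varepsilon_k>0$ satisfy $$\sum_{k=1}^\infty\alpha_k=\infty,\qquad \sum_{k=1}^\infty\alpha_k^2<\infty,\qquad \sum_{k=1}^\infty\alpha_k\varepsilon_k<\infty .$$ Let $\mathbf{z}(k)=(\mathbf{x}(k),\mathbf{v}(k))$, $k\ge1$, be a sequence generated by the normalized algorithm: for $i=1,\dots,N$, $$x_i(k+1)=P_{X_i}\Big[x_i(k)-\frac{\alpha_k}{\max\{c,\delta_{ik,D}\}}\big(g_i(k)+\hat x_i(k)+\hat v_i(k)\big)\Big],\qquad v_i(k+1)=v_i(k)+\frac{\alpha_k}{\max\{c,\delta_{ik,D}\}}\hat x_i(k),$$ where $g_i(k)\in\partial_{\varepsilon_k}f_i(x_i(k))$, $\delta_{ik,1}=\|T^i_{\varepsilon_k}(\mathbf{z}(k))\|$,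 and $\delta_{ik,m}=\max_{j\in\mathcal{N}_i}\{\delta_{ik,m-1},\delta_{jk,m-1}\}$ for $2\le m\le D$. Let $\mathbf{z}^*=(\mathbf{x}^*,\mathbf{v}^* )$ be a saddle point of $\Phi$ in $\tilde X\times\mathbb{R}^N$. Then: 1) the sequence $\{\|\mathbf{z}(k+1)-\mathbf{z}^*\|\}$ converges; 2) $\lim_{k\to\infty}[x_i(k)-x_j(k)]=0$ for all $i,j\in\{1,\dots,N\}$, and $\lim_{k\to\infty}\tilde f(\mathbf{x}(k))=\tilde f(\mathbf{x}^* )=f^*$; 3) $\{\mathbf{z}(k)\}$ has at least one cluster point $\bar{\mathbf{z}}=(\bar{\mathbf{x}},\bar{\mathbf{v}})$ such that $\bar{\mathbf{x}}=\mathbf{1}_N x^*$ with $x^*\in\mathcal{X}^*$; 4) if $\mathcal{X}^*=\{x^*\}$ is a singleton, then $\lim_{k\to\infty}x_i(k)=x^*$ for each $i\in\{1,\dots,N\}$.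
   Context: Graph: $\mathcal{G}$ has symmetric weights $a_{ij}=a_{ji}\ge0$, $a_{ii}=0$, with $a_{ij}>0$ iff there is an edge between $i$ and $j$; $\mathcal{N}_i$ is the set of neighbors of $i$. Its Laplacian $L=[l_{ij}]\in\mathbb{R}^{N\times N}$ is $l_{ii}=\sum_{j\ne i}a_{ij}$, $l_{ij}=-a_{ij}$ for $j\neq i$. The diameter is the largest (unweighted) graph distance between two nodes. $\varepsilon$-subgradient: for a convex $f:\mathbb{R}^m\to\mathbb{R}$ and $\varepsilon>0$, a vector $g$ is an $\varepsilon$-subgradient of $f$ at $x$ if $f(y)\ge f(x)+g^\top(y-x)-\varepsilon$ for all $y\in\mathbb{R}^m$; $\partial_\varepsilon f(x)$ is the set of all $\varepsilon$-subgradients of $f$ at $x$. $P_{X_i}$ is the Euclidean projection onto the closed convex set $X_i$; $\mathbf{1}_N\in\mathbb{R}^N$ is the all-ones vector; $\|\cdot\|$ is the Euclidean norm. Notation: $\mathbf{x}=(x_1,\dots,x_N)^\top$, $\mathbf{v}=(v_1,\dots,v_N)^\top\in\mathbb{R}^N$, $\tilde X=X_1\times\cdots\times X_N$, $\tilde f(\mathbf{x})=\sum_{i=1}^N f_i(x_i)$, $\hat x_i(k)=\sum_{j=1}^N a_{ij}(x_i(k)-x_j(k))$, $\hat v_i(k)=\sum_{j=1}^N a_{ij}(v_i(k)-v_j(k))$, and $$T^i_{\varepsilon_k}(\mathbf{z}(k))=\begin{bmatrix} g_i(k)+\hat x_i(k)+\hat v_i(k)\\ -\hat x_i(k)\end{bmatrix}\in\mathbb{R}^2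 .$$ The initial values $\mathbf{x}(1),\mathbf{v}(1)$ are given. Augmented Lagrangian: $\Phi(\mathbf{x},\mathbf{v})=\tilde f(\mathbf{x})+\mathbf{v}^\top L\mathbf{x}+\tfrac12\mathbf{x}^\top L\mathbf{x}$. A pair $(\mathbf{x}^*,\mathbf{v}^* )\in\tilde X\times\mathbb{R}^N$ is a saddle point of $\Phi$ in $\tilde X\times\mathbb{R}^N$ if $\Phi(\mathbf{x}^*,\mathbf{v})\le\Phi(\mathbf{x}^*,\mathbf{v}^* )\le\Phi(\mathbf{x},\mathbf{v}^* )$ for all $\mathbf{x}\in\tilde X$, $\mathbf{v}\in\mathbb{R}^N$. *)

theory Defs
  imports "HOL-Analysis.Analysis"
begin

text \<open>The nodes are the elements of a finite (hence nonempty) type \<open>'n\<close>, so that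
  \<open>N = CARD('n) \<ge> 1\<close>; a weighted graph is given by its weights \<open>a i j\<close>, and \<open>i\<close>, \<open>j\<close> are
  adjacent iff \<open>a i j > 0\<close>.\<close>

definition weighted_graph :: "('n \<Rightarrow> 'n \<Rightarrow> real) \<Rightarrow> bool" where
  "weighted_graph a \<longleftrightarrow>
     (\<forall>i j. a i j = a j i) \<and> (\<forall>i j. a i j \<ge> 0) \<and> (\<forall>i. a i i = 0)"

definition neighbors :: "('n \<Rightarrow> 'n \<Rightarrow> real) \<Rightarrow> 'n \<Rightarrow> 'n set" where
  "neighbors a i = {j. a i j > 0}"

definition edges :: "('n \<Rightarrow> 'n \<Rightarrow> real) \<Rightarrow> ('n \<times> 'n) set" where
  "edges a = {(i, j). a i j > 0}"

definition connected_graph :: "('n \<Rightarrow> 'n \<Rightarrow> real) \<Rightarrow> bool" where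
  "connected_graph a \<longleftrightarrow> (\<forall>i j. (i, j) \<in> (edges a)\<^sup>*)"

text \<open>The relational power \<open>edges a ^^ n\<close> relates the end points of walks with \<open>n\<close> edges.
  Distance and diameter are meaningful for connected graphs only.\<close>

definition graph_dist :: "('n \<Rightarrow> 'n \<Rightarrow> real) \<Rightarrow> 'n \<Rightarrow> 'n \<Rightarrow> nat" where
  "graph_dist a i j = (LEAST n. (i, j) \<in> edges a ^^ n)"

definition graph_diameter :: "('n::finite \<Rightarrow> 'n \<Rightarrow> real) \<Rightarrow> nat" where
  "graph_diameter a = Max {graph_dist a i j | i j. True}"

definition laplacian :: "('n::finite \<Rightarrow> 'n \<Rightarrow> real) \<Rightarrow> real ^ 'n ^ 'n" where
  "laplacian a = (\<chi> i j. if i = j then (\<Sum>k\<in>UNIV - {i}. a i k) else - a i j)"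

definition eps_subdifferential :: "('a::real_inner \<Rightarrow> real) \<Rightarrow> real \<Rightarrow> 'a \<Rightarrow> 'a set" where
  "eps_subdifferential f e x = {g. \<forall>y. f y \<ge> f x + g \<bullet> (y - x) - e}"

definition product_set :: "('n::finite \<Rightarrow> real set) \<Rightarrow> (real ^ 'n) set" where
  "product_set X = {x. \<forall>i. x $ i \<in> X i}"

definition separable_sum :: "('n::finite \<Rightarrow> real \<Rightarrow> real) \<Rightarrow> real ^ 'n \<Rightarrow> real" where
  "separable_sum f x = (\<Sum>i\<in>UNIV. f i (x $ i))"

definition aug_lagrangian ::
  "('n::finite \<Rightarrow> real \<Rightarrow> real) \<Rightarrow> ('n \<Rightarrow> 'n \<Rightarrow> real) \<Rightarrow> real ^ 'n \<Rightarrow> real ^ 'n \<Rightarrow> real" where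
  "aug_lagrangian f a x v =
     separable_sum f x + v \<bullet> (laplacian a *v x) + (1/2) * (x \<bullet> (laplacian a *v x))"

definition saddle_point :: "('a \<Rightarrow> 'b \<Rightarrow> real) \<Rightarrow> 'a set \<Rightarrow> 'b set \<Rightarrow> 'a \<Rightarrow> 'b \<Rightarrow> bool" where
  "saddle_point \<Phi> A B xs vs \<longleftrightarrow> xs \<in> A \<and> vs \<in> B \<and>
     (\<forall>x\<in>A. \<forall>v\<in>B. \<Phi> xs v \<le> \<Phi> xs vs \<and> \<Phi> xs vs \<le> \<Phi> x vs)"

definition disagreement :: "('n::finite \<Rightarrow> 'n \<Rightarrow> real) \<Rightarrow> real ^ 'n \<Rightarrow> 'n \<Rightarrow> real" where
  "disagreement a x i = (\<Sum>j\<in>UNIV. a i j * (x $ i - x $ j))"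

text \<open>The vector \<open>T\<^sup>i\<close> in the plane, as a pair: the norm of \<open>real \<times> real\<close> is the Euclidean one.\<close>

definition direction ::
  "('n::finite \<Rightarrow> 'n \<Rightarrow> real) \<Rightarrow> real \<Rightarrow> real ^ 'n \<Rightarrow> real ^ 'n \<Rightarrow> 'n \<Rightarrow> real \<times> real" where
  "direction a g x v i =
     (g + disagreement a x i + disagreement a v i, - disagreement a x i)"

definition cluster_point :: "(nat \<Rightarrow> 'a::metric_space) \<Rightarrow> 'a \<Rightarrow> bool" where
  "cluster_point z l \<longleftrightarrow> (\<exists>r. strict_mono r \<and> (z \<circ> r) \<longlonglongrightarrow> l)"

end

theory Submission
  imports Defs
begin

text \<open>After \<open>D\<close> rounds of taking maxima over neighbours, every node holds the same normalizer, namely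
  the maximum of the norms of the local directions. The method is thus a centralized projected subgradient
  method with step sizes \<open>\<gamma>\<^sub>k = \<alpha>\<^sub>k / max c M\<^sub>k\<close>, and
  \<open>dist(z\<^sub>k\<^sub>+\<^sub>1, z*)\<^sup>2 \<le> dist(z\<^sub>k, z*)\<^sup>2 - 2 \<gamma>\<^sub>k S\<^sub>k + q\<^sub>k\<close>,
  where \<open>q\<close> is summable and \<open>S\<^sub>k \<ge> 0\<close> is the Lagrangian gap of \<open>x\<^sub>k\<close> plus half of the Laplacian quadratic
  form. Hence the distances converge and \<open>\<gamma>\<^sub>k S\<^sub>k\<close> is summable. As \<open>M\<^sub>k \<le> C (1 + \<epsilon>\<^sub>k)\<close> on the bounded
  iterates, \<open>\<gamma>\<close> is not summable while \<open>S\<close> varies by at most \<open>C \<gamma>\<^sub>k\<close> plus a summable term, which forces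
  \<open>S\<^sub>k \<longlonglongrightarrow> 0\<close>. This bounds both the disagreement and the suboptimality.\<close>

section \<open>Real sequences\<close>

text \<open>Adding the partial sums of \<open>p\<close> to \<open>u\<close> and subtracting those of
  \<open>q\<close> gives a decreasing sequence that is bounded below by \<open>- suminf q\<close>.
  Its decrease also bounds the partial sums of \<open>p\<close>.\<close>

lemma quasi_fejer:
  fixes u p q :: "nat \<Rightarrow> real"
  assumes step: "\<And>k. u (Suc k) \<le> u k - p k + q k"
    and u: "\<And>k. u k \<ge> 0" and p: "\<And>k. p k \<ge> 0"
    and q: "\<And>k. q k \<ge> 0" "summable q"
  shows "convergent u" and "summable p"
proof -
  define w where "w k = u k + (\<Sum>j<k. p j) - (\<Sum>j<k. q j)" for k
  have w_mono: "w (Suc k) \<le> w k" for k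
    using step[of k] by (simp add: w_def)
  then have dec: "decseq w"
    by (simp add: decseq_Suc_iff)
  have q_le: "(\<Sum>j<k. q j) \<le> suminf q" for k
    using q by (intro sum_le_suminf) auto
  have p_le: "(\<Sum>j<k. p j) \<le> w 0 + suminf q" for k
    using decseqD[OF dec, of 0 k] q_le[of k] u[of k] by (simp add: w_def)
  have w_ge: "- suminf q \<le> w k" for k
    using q_le[of k] u[of k] sum_nonneg[of "{..<k}" p] p by (simp add: w_def)
  show p_sum: "summable p"
    using p p_le by (intro summableI_nonneg_bounded) auto
  obtain l where "w \<longlonglongrightarrow> l"
    using decseq_convergent[OF dec, of "- suminf q"] w_ge by blast
  then have "(\<lambda>k. w k - (\<Sum>j<k. p j) + (\<Sum>j<k. q j)) \<longlonglongrightarrow> l - suminf p + suminf q"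
    using p_sum q by (intro tendsto_intros summable_LIMSEQ)
  moreover have "(\<lambda>k. w k - (\<Sum>j<k. p j) + (\<Sum>j<k. q j)) = u"
    by (auto simp: w_def)
  ultimately show "convergent u"
    by (auto simp: convergent_def)
qed

text \<open>Summability against non-summable weights alone only brings \<open>S\<close> close to
  zero infinitely often. The control of the increments makes \<open>S\<close> converge, and a
  positive limit would make \<open>\<gamma>\<close> summable.\<close>

lemma tendsto_zero_of_summable_weighted:
  fixes S \<gamma> \<eta> :: "nat \<Rightarrow> real"
  assumes S: "\<And>k. S k \<ge> 0" "\<And>k. S k \<le> B" and \<gamma>: "\<And>k. \<gamma> k \<ge> 0" "\<not> summable \<gamma>"
    and \<gamma>S: "summable (\<lambda>k. \<gamma> k * S k)"
    and incr: "\<And>k. \<bar>S (Suc k) - S k\<bar> \<le> C * \<gamma> k + \<eta> k"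
    and \<eta>: "\<And>k. \<eta> k \<ge> 0" "summable \<eta>"
    and sq: "summable (\<lambda>k. (S (Suc k) - S k)\<^sup>2)"
  shows "S \<longlonglongrightarrow> 0"
proof -
  \<comment> \<open>Unlike the increments of \<open>S\<close>, those of \<open>S\<^sup>2\<close> carry a factor \<open>S\<close> and are absolutely summable.\<close>
  have bound: "\<bar>(S (Suc k))\<^sup>2 - (S k)\<^sup>2\<bar>
      \<le> 2 * C * (\<gamma> k * S k) + 2 * B * \<eta> k + (S (Suc k) - S k)\<^sup>2" for k
  proof -
    have "(S (Suc k))\<^sup>2 - (S k)\<^sup>2 = 2 * S k * (S (Suc k) - S k) + (S (Suc k) - S k)\<^sup>2"
      by (simp add: power2_eq_square algebra_simps)
    then have "\<bar>(S (Suc k))\<^sup>2 - (S k)\<^sup>2\<bar> \<le> 2 * S k * \<bar>S (Suc k) - S k\<bar> + (S (Suc k) - S k)\<^sup>2"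
      using abs_triangle_ineq[of "2 * S k * (S (Suc k) - S k)" "(S (Suc k) - S k)\<^sup>2"] S(1)[of k]
      by (simp add: abs_mult)
    also have "2 * S k * \<bar>S (Suc k) - S k\<bar> \<le> 2 * S k * (C * \<gamma> k + \<eta> k)"
      using incr[of k] S(1)[of k] by (intro mult_left_mono) auto
    also have "\<dots> \<le> 2 * C * (\<gamma> k * S k) + 2 * B * \<eta> k"
      using mult_right_mono[OF S(2)[of k] \<eta>(1)[of k]] by (simp add: algebra_simps)
    finally show ?thesis by simp
  qed
  have "summable (\<lambda>k. (S (Suc k))\<^sup>2 - (S k)\<^sup>2)"
    by (rule summable_comparison_test'[where N = 0 and
        g = "\<lambda>k. 2 * C * (\<gamma> k * S k) + 2 * B * \<eta> k + (S (Suc k) - S k)\<^sup>2"])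
      (use bound in \<open>auto intro!: summable_add summable_mult \<gamma>S \<eta> sq\<close>)
  then have "(\<lambda>n. \<Sum>k<n. (S (Suc k))\<^sup>2 - (S k)\<^sup>2) \<longlonglongrightarrow> (\<Sum>k. (S (Suc k))\<^sup>2 - (S k)\<^sup>2)"
    by (rule summable_LIMSEQ)
  then obtain l where "(\<lambda>n. (S n)\<^sup>2 - (S 0)\<^sup>2) \<longlonglongrightarrow> l"
    by (auto simp: sum_lessThan_telescope[where f = "\<lambda>k. (S k)\<^sup>2"])
  from tendsto_add[OF this tendsto_const[of "(S 0)\<^sup>2"]]
  have "(\<lambda>n. (S n)\<^sup>2) \<longlonglongrightarrow> l + (S 0)\<^sup>2"
    by simp
  from tendsto_real_sqrt[OF this] obtain s where s: "S \<longlonglongrightarrow> s"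
    using S(1) by auto
  have "s = 0"
  proof (rule ccontr)
    assume "s \<noteq> 0"
    moreover have "s \<ge> 0"
      using LIMSEQ_le_const[OF s] S(1) by blast
    ultimately have "s > s / 2" "s > 0"
      by auto
    then obtain m where m: "\<And>k. k \<ge> m \<Longrightarrow> S k > s / 2"
      using order_tendstoD(1)[OF s \<open>s > s / 2\<close>] by (auto simp: eventually_sequentially)
    have "summable \<gamma>"
    proof (rule summable_comparison_test'[where N = m])
      show "summable (\<lambda>k. 2 / s * (\<gamma> k * S k))"
        by (intro summable_mult \<gamma>S)
      show "norm (\<gamma> k) \<le> 2 / s * (\<gamma> k * S k)" if "k \<ge> m" for k
        using mult_left_mono[OF less_imp_le[OF m[OF that]] \<gamma>(1)[of k]] \<open>s > 0\<close> \<gamma>(1)[of k]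
        by (simp add: field_simps)
    qed
    with \<gamma>(2) show False by simp
  qed
  with s show ?thesis by simp
qed

section \<open>Convex functions on bounded sets\<close>

text \<open>Extending the segment from \<open>w\<close> to \<open>u\<close> by one unit beyond
  \<open>u\<close> stays in the ball of radius \<open>R + 1\<close>, where the absolute value of
  \<open>f\<close> is at most \<open>B\<close>. By convexity the slope from \<open>w\<close> to
  \<open>u\<close> is at most the slope over the extension, hence at most
  \<open>2 * B\<close>.\<close>

lemma convex_on_lipschitz_cball:
  fixes f :: "'a::euclidean_space \<Rightarrow> real"
  assumes f: "convex_on UNIV f"
  obtains K where "K \<ge> 0" "\<And>u w. u \<in> cball 0 R \<Longrightarrow> w \<in> cball 0 R \<Longrightarrow> \<bar>f u - f w\<bar> \<le> K * norm (u - w)"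
proof -
  have "compact (f ` cball 0 (R + 1))"
    using convex_on_continuous[OF open_UNIV f]
    by (intro compact_continuous_image) (auto intro: continuous_on_subset)
  then obtain B where B: "B > 0" "\<And>y. norm y \<le> R + 1 \<Longrightarrow> \<bar>f y\<bar> \<le> B"
    using compact_imp_bounded by (force simp: bounded_pos)
  have le: "f u - f w \<le> 2 * B * norm (u - w)"
    if u: "u \<in> cball 0 R" and w: "w \<in> cball 0 R" and "u \<noteq> w" for u w
  proof -
    define d where "d = norm (u - w)"
    define t where "t = u + sgn (u - w)"
    have d: "d > 0" and sgn: "d *\<^sub>R sgn (u - w) = u - w"
      using \<open>u \<noteq> w\<close> by (auto simp: d_def sgn_div_norm)
    have "norm t \<le> R + 1"
      using norm_triangle_ineq[of u "sgn (u - w)"] u \<open>u \<noteq> w\<close> by (simp add: t_def norm_sgn)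
    then have ftu: "f t - f u \<le> 2 * B"
      using B(2)[of t] B(2)[of u] u by auto
    have "(1 + d) *\<^sub>R ((1 / (1 + d)) *\<^sub>R w + (d / (1 + d)) *\<^sub>R t) = w + d *\<^sub>R t"
      using d by (simp add: scaleR_add_right)
    also have "\<dots> = (1 + d) *\<^sub>R u"
      using sgn by (simp add: t_def algebra_simps)
    finally have "(1 / (1 + d)) *\<^sub>R w + (d / (1 + d)) *\<^sub>R t = u"
      using d by simp
    moreover have "1 - d / (1 + d) = 1 / (1 + d)"
      using d by (simp add: field_simps)
    ultimately have "f u \<le> (f w + d * f t) / (1 + d)"
      using convex_onD[OF f, of "d / (1 + d)" w t] d by (simp add: add_divide_distrib)
    then have "f u - f w \<le> d * (f t - f u)"
      using d by (simp add: pos_le_divide_eq algebra_simps)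
    also have "\<dots> \<le> d * (2 * B)"
      using d ftu by (intro mult_left_mono) auto
    finally show ?thesis by (simp add: d_def mult.commute)
  qed
  have "\<bar>f u - f w\<bar> \<le> 2 * B * norm (u - w)" if "u \<in> cball 0 R" "w \<in> cball 0 R" for u w
    using le[of u w] le[of w u] that by (cases "u = w") (auto simp: norm_minus_commute abs_le_iff)
  with B(1) show ?thesis
    by (intro that[of "2 * B"]) auto
qed

text \<open>The subgradient inequality is tested at distance one from \<open>x\<close> in the
  direction of \<open>g\<close>. There the linear term equals \<open>norm g\<close>, while
  \<open>f\<close> grows by at most its Lipschitz constant on the ball of radius
  \<open>R + 1\<close>.\<close>

lemma eps_subdifferential_norm_le:
  fixes f :: "'a::euclidean_space \<Rightarrow> real"
  assumes f: "convex_on UNIV f"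
  obtains K where "K \<ge> 0"
    "\<And>x e g. x \<in> cball 0 R \<Longrightarrow> e \<ge> 0 \<Longrightarrow> g \<in> eps_subdifferential f e x \<Longrightarrow> norm g \<le> K + e"
proof -
  obtain K where K: "K \<ge> 0"
    "\<And>u w. u \<in> cball 0 (R + 1) \<Longrightarrow> w \<in> cball 0 (R + 1) \<Longrightarrow> \<bar>f u - f w\<bar> \<le> K * norm (u - w)"
    using convex_on_lipschitz_cball[OF f] by metis
  have "norm g \<le> K + e"
    if x: "x \<in> cball 0 R" and e: "e \<ge> 0" and g: "g \<in> eps_subdifferential f e x" for x e g
  proof (cases "g = 0")
    case False
    have "norm (x + sgn g) \<le> R + 1"
      using norm_triangle_ineq[of x "sgn g"] x False by (simp add: norm_sgn)
    then have "f (x + sgn g) - f x \<le> K"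
      using K(2)[of "x + sgn g" x] x False by (simp add: norm_sgn)
    moreover have "f (x + sgn g) \<ge> f x + g \<bullet> (x + sgn g - x) - e"
      using g unfolding eps_subdifferential_def by blast
    moreover have "g \<bullet> sgn g = norm g"
      using False by (simp add: sgn_div_norm dot_square_norm power2_eq_square)
    ultimately show ?thesis by simp
  qed (use K e in auto)
  with K(1) show ?thesis using that by blast
qed

section \<open>Graph Laplacians and consensus\<close>

lemma laplacian_mult_vec:
  assumes "weighted_graph a"
  shows "(laplacian a *v x) $ i = disagreement a x i"
proof -
  have aii: "a i i = 0"
    using assms by (simp add: weighted_graph_def)
  have "(laplacian a *v x) $ i
      = (\<Sum>k\<in>UNIV - {i}. a i k) * x $ i + (\<Sum>j\<in>UNIV - {i}. - a i j * x $ j)"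
    unfolding matrix_vector_mult_def laplacian_def by (simp add: sum.remove[of UNIV i])
  also have "\<dots> = (\<Sum>j\<in>UNIV - {i}. a i j * (x $ i - x $ j))"
    by (simp add: sum_distrib_right right_diff_distrib sum_negf sum_subtractf)
  also have "\<dots> = disagreement a x i"
    by (simp add: disagreement_def sum.remove[of UNIV i] aii)
  finally show ?thesis .
qed

lemma inner_laplacian:
  assumes "weighted_graph a"
  shows "y \<bullet> (laplacian a *v x) = (\<Sum>i\<in>UNIV. y $ i * disagreement a x i)"
  by (simp add: inner_vec_def laplacian_mult_vec[OF assms])

text \<open>Symmetric weights allow the two summation indices to be exchanged; averaging both
  expressions gives the edge form. Symmetry and nonnegativity of the Laplacian form can be read off
  from it.\<close>

lemma inner_laplacian_edges:
  assumes "weighted_graph a"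
  shows "y \<bullet> (laplacian a *v x)
    = (1/2) * (\<Sum>i\<in>UNIV. \<Sum>j\<in>UNIV. a i j * ((y $ i - y $ j) * (x $ i - x $ j)))"
proof -
  have sym: "a i j = a j i" for i j
    using assms by (simp add: weighted_graph_def)
  have 1: "y \<bullet> (laplacian a *v x) = (\<Sum>i\<in>UNIV. \<Sum>j\<in>UNIV. a i j * (y $ i * (x $ i - x $ j)))"
    by (simp add: inner_laplacian[OF assms] disagreement_def sum_distrib_left mult_ac)
  also have "\<dots> = (\<Sum>j\<in>UNIV. \<Sum>i\<in>UNIV. a i j * (y $ i * (x $ i - x $ j)))"
    by (rule sum.swap)
  also have "\<dots> = (\<Sum>i\<in>UNIV. \<Sum>j\<in>UNIV. a i j * (y $ j * (x $ j - x $ i)))"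
    by (simp add: sym)
  finally have 2: "y \<bullet> (laplacian a *v x) = (\<Sum>i\<in>UNIV. \<Sum>j\<in>UNIV. a i j * (y $ j * (x $ j - x $ i)))" .
  have "2 * (y \<bullet> (laplacian a *v x))
      = (\<Sum>i\<in>UNIV. \<Sum>j\<in>UNIV. a i j * (y $ i * (x $ i - x $ j)) + a i j * (y $ j * (x $ j - x $ i)))"
    using 1 2 by (simp add: sum.distrib)
  also have "\<dots> = (\<Sum>i\<in>UNIV. \<Sum>j\<in>UNIV. a i j * ((y $ i - y $ j) * (x $ i - x $ j)))"
    by (intro sum.cong refl) (simp add: algebra_simps)
  finally show ?thesis by simp
qed

lemma inner_laplacian_commute:
  assumes "weighted_graph a"
  shows "y \<bullet> (laplacian a *v x) = x \<bullet> (laplacian a *v y)"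
  by (simp add: inner_laplacian_edges[OF assms] mult.commute)

lemma laplacian_form_nonneg:
  assumes "weighted_graph a"
  shows "x \<bullet> (laplacian a *v x) \<ge> 0"
  using assms by (auto simp: inner_laplacian_edges weighted_graph_def intro!: sum_nonneg)

lemma laplacian_form_ge_edge:
  assumes "weighted_graph a"
  shows "a i j * (x $ i - x $ j)\<^sup>2 \<le> 2 * (x \<bullet> (laplacian a *v x))"
proof -
  have nonneg: "a i j * (x $ i - x $ j)\<^sup>2 \<ge> 0" for i j
    using assms by (simp add: weighted_graph_def)
  have "a i j * (x $ i - x $ j)\<^sup>2 \<le> (\<Sum>j\<in>UNIV. a i j * (x $ i - x $ j)\<^sup>2)"
    using nonneg by (intro member_le_sum) auto
  also have "\<dots> \<le> (\<Sum>i\<in>UNIV. \<Sum>j\<in>UNIV. a i j * (x $ i - x $ j)\<^sup>2)"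
    using nonneg by (intro member_le_sum[of i UNIV "\<lambda>i. \<Sum>j\<in>UNIV. a i j * (x $ i - x $ j)\<^sup>2"] sum_nonneg) auto
  also have "\<dots> = 2 * (x \<bullet> (laplacian a *v x))"
    by (simp add: inner_laplacian_edges[OF assms] power2_eq_square)
  finally show ?thesis .
qed

text \<open>The form dominates the weighted squared difference across each edge, so these
  differences vanish; along a path from \<open>i\<close> to \<open>j\<close> they add up.\<close>

lemma consensus_of_laplacian_form:
  assumes "weighted_graph a" "connected_graph a"
    and lim: "(\<lambda>k. x k \<bullet> (laplacian a *v x k)) \<longlonglongrightarrow> 0"
  shows "(\<lambda>k. x k $ i - x k $ j) \<longlonglongrightarrow> 0"
proof -
  have edge: "(\<lambda>k. x k $ i - x k $ j) \<longlonglongrightarrow> 0" if "(i, j) \<in> edges a" for i j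
  proof -
    have aij: "a i j > 0"
      using that by (simp add: edges_def)
    have "(\<lambda>k. 2 / a i j * (x k \<bullet> (laplacian a *v x k))) \<longlonglongrightarrow> 0"
      using tendsto_mult_right_zero[OF lim] .
    then have "(\<lambda>k. (x k $ i - x k $ j)\<^sup>2) \<longlonglongrightarrow> 0"
    proof (rule tendsto_0_le[where K = 1], intro always_eventually allI)
      fix k
      show "norm ((x k $ i - x k $ j)\<^sup>2) \<le> norm (2 / a i j * (x k \<bullet> (laplacian a *v x k))) * 1"
        using laplacian_form_ge_edge[OF assms(1), of i j "x k"] aij
          laplacian_form_nonneg[OF assms(1), of "x k"]
        by (simp add: field_simps)
    qed
    then show ?thesis by simp
  qed
  have "(i, j) \<in> (edges a)\<^sup>*"
    using assms(2) by (simp add: connected_graph_def)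
  then show ?thesis
  proof (induction rule: rtrancl_induct)
    case (step y z)
    from tendsto_add[OF step.IH edge[OF step.hyps(2)]] show ?case by simp
  qed simp
qed

text \<open>This is consensus for a constant sequence: a constant difference that tends to zero is
  zero.\<close>

lemma laplacian_kernel_constant:
  assumes "weighted_graph a" "connected_graph a" "laplacian a *v x = 0"
  shows "x $ i = x $ j"
  using consensus_of_laplacian_form[OF assms(1,2), of "\<lambda>_. x" i j] assms(3)
  by (simp add: LIMSEQ_const_iff)

lemma laplacian_mult_constant:
  assumes "weighted_graph a"
  shows "laplacian a *v (\<chi> i. y) = 0"
  by (simp add: vec_eq_iff laplacian_mult_vec[OF assms] disagreement_def)

text \<open>No round exceeds the maximum of the initial values, and a value travels one edge per
  round, so the largest one reaches every node within the diameter.\<close>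

lemma max_consensus:
  fixes a :: "'n::finite \<Rightarrow> 'n \<Rightarrow> real" and \<delta> :: "'n \<Rightarrow> nat \<Rightarrow> real"
  assumes graph: "weighted_graph a" and conn: "connected_graph a" and D: "D \<ge> graph_diameter a + 1"
    and step: "\<And>i m. 2 \<le> m \<Longrightarrow> m \<le> D \<Longrightarrow>
        \<delta> i m = Max (insert (\<delta> i (m - 1)) ((\<lambda>j. \<delta> j (m - 1)) ` neighbors a i))"
  shows "\<delta> i D = Max (range (\<lambda>j. \<delta> j 1))"
proof (rule antisym)
  have "\<delta> i (Suc m) \<le> Max (range (\<lambda>j. \<delta> j 1))" if "Suc m \<le> D" for m i
    using that
  proof (induction m arbitrary: i)
    case (Suc m)
    then have "\<delta> i (Suc (Suc m)) = Max (insert (\<delta> i (Suc m)) ((\<lambda>j. \<delta> j (Suc m)) ` neighbors a i))"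
      using step[of "Suc (Suc m)" i] by simp
    also have "\<dots> \<le> Max (range (\<lambda>j. \<delta> j 1))"
      by (intro Max.boundedI) (use Suc in auto)
    finally show ?case .
  qed simp
  from this[of "D - 1"] show "\<delta> i D \<le> Max (range (\<lambda>j. \<delta> j 1))"
    using D by simp
next
  \<comment> \<open>Each maximum includes the node's own previous value, so a lower bound once
    reached persists.\<close>
  have mono: "\<delta> i (Suc m) \<le> \<delta> i m'" if "Suc m \<le> m'" "m' \<le> D" for i m m'
    using that
  proof (induction m' rule: dec_induct)
    case (step n)
    have "\<delta> i n \<le> \<delta> i (Suc n)"
      using step assms(4)[of "Suc n" i] by simp
    with step show ?case by simp
  qed simp
  \<comment> \<open>Rounds are numbered from 1, so a walk with \<open>m\<close> edges delivers the
    initial value of \<open>j\<close> at index \<open>Suc m\<close>. This is why \<open>D\<close> is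
    at least the diameter plus one.\<close>
  have walk: "\<delta> j 1 \<le> \<delta> i (Suc m)" if "(i, j) \<in> edges a ^^ m" "Suc m \<le> D" for i j m
    using that
  proof (induction m arbitrary: i)
    case (Suc m)
    from Suc.prems(1) obtain l where l: "(i, l) \<in> edges a" "(l, j) \<in> edges a ^^ m"
      using relpow_Suc_D2 by metis
    have "\<delta> j 1 \<le> \<delta> l (Suc m)"
      using Suc.IH[OF l(2)] Suc.prems(2) by simp
    also have "\<dots> \<le> \<delta> i (Suc (Suc m))"
      using step[of "Suc (Suc m)" i] Suc.prems(2) l(1) by (simp add: edges_def neighbors_def)
    finally show ?case .
  qed simp
  show "Max (range (\<lambda>j. \<delta> j 1)) \<le> \<delta> i D"
  proof (intro Max.boundedI)
    fix b assume "b \<in> range (\<lambda>j. \<delta> j 1)"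
    then obtain j where b: "b = \<delta> j 1" by auto
    \<comment> \<open>Connectedness provides some walk, so the \<open>LEAST\<close> in
      \<open>graph_dist\<close> is attained.\<close>
    have "\<exists>n. (i, j) \<in> edges a ^^ n"
      using conn rtrancl_imp_relpow by (fastforce simp: connected_graph_def)
    then have path: "(i, j) \<in> edges a ^^ graph_dist a i j"
      unfolding graph_dist_def by (rule LeastI_ex)
    have "{graph_dist a i j | i j. True} = (\<lambda>(i, j). graph_dist a i j) ` UNIV"
      by auto
    then have "graph_dist a i j \<le> graph_diameter a"
      unfolding graph_diameter_def by (intro Max_ge) auto
    then have dist: "Suc (graph_dist a i j) \<le> D"
      using D by simp
    show "b \<le> \<delta> i D"
      using walk[OF path dist] mono[of "graph_dist a i j" D i] dist b by simp
  qed auto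
qed

lemma norm_matrix_vector_le:
  fixes A :: "real ^ 'n ^ 'm"
  obtains K where "K \<ge> 0" "\<And>x. norm (A *v x) \<le> K * norm x"
proof -
  obtain K where "K > 0" "\<And>x. norm (A *v x) \<le> norm x * K"
    using bounded_linear.pos_bounded[OF matrix_vector_mul_bounded_linear[of A]] by auto
  then show ?thesis
    using that[of K] by (simp add: mult.commute)
qed

lemma norm_pair_diff_sq:
  fixes y w y' w' :: "real ^ 'n"
  shows "(norm ((y, w) - (y', w')))\<^sup>2 = (\<Sum>i\<in>UNIV. (y $ i - y' $ i)\<^sup>2 + (w $ i - w' $ i)\<^sup>2)"
  unfolding power2_norm_eq_inner
  by (simp add: inner_vec_def sum.distrib power2_eq_square)

section \<open>The primal-dual iteration\<close>

locale primal_dual_saddle =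
  fixes f :: "'n::finite \<Rightarrow> real \<Rightarrow> real" and Xi :: "'n \<Rightarrow> real set"
    and a :: "'n \<Rightarrow> 'n \<Rightarrow> real" and xs vs :: "real ^ 'n"
  assumes f_convex: "\<And>i. convex_on UNIV (f i)"
    and X_closed: "\<And>i. closed (Xi i)" and X_convex: "\<And>i. convex (Xi i)"
    and graph: "weighted_graph a" and conn: "connected_graph a"
    and saddle: "saddle_point (aug_lagrangian f a) (product_set Xi) UNIV xs vs"
begin

abbreviation L :: "real ^ 'n ^ 'n" where "L \<equiv> laplacian a"

section \<open>Consequences of the saddle point inequalities\<close>

lemma saddle_mem: "xs \<in> product_set Xi"
  using saddle by (simp add: saddle_point_def)

text \<open>The Lagrangian at \<open>xs\<close> is affine in the multiplier with slope
  \<open>L *v xs\<close>. Moving from the maximizer \<open>vs\<close> along this slope cannot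
  increase it, so the slope is zero.\<close>

lemma saddle_consensus: "L *v xs = 0"
proof -
  have "aug_lagrangian f a xs (vs + L *v xs) \<le> aug_lagrangian f a xs vs"
    using saddle by (auto simp: saddle_point_def)
  then have "(L *v xs) \<bullet> (L *v xs) \<le> 0"
    by (simp add: aug_lagrangian_def inner_left_distrib)
  then show ?thesis
    by (metis inner_eq_zero_iff inner_ge_zero order_antisym)
qed

text \<open>Since \<open>L *v xs = 0\<close>, this is \<open>\<Phi>(y, vs) - \<Phi>(xs, vs)\<close> plus half of the quadratic form, where \<open>\<Phi>\<close>
  is the augmented Lagrangian.\<close>

definition gap :: "real ^ 'n \<Rightarrow> real" where
  "gap y = separable_sum f y - separable_sum f xs + vs \<bullet> (L *v y) + y \<bullet> (L *v y)"

text \<open>The saddle inequality makes the Lagrangian difference nonnegative. That difference uses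
  only half of the quadratic form in \<open>gap\<close>; the other half remains as the lower
  bound.\<close>

lemma gap_ge:
  assumes "y \<in> product_set Xi"
  shows "gap y \<ge> (1/2) * (y \<bullet> (L *v y))"
proof -
  have "aug_lagrangian f a xs vs \<le> aug_lagrangian f a y vs"
    using saddle assms by (simp add: saddle_point_def)
  then show ?thesis
    by (simp add: aug_lagrangian_def gap_def saddle_consensus)
qed

lemma gap_nonneg:
  assumes "y \<in> product_set Xi"
  shows "gap y \<ge> 0"
  using gap_ge[OF assms] laplacian_form_nonneg[OF graph, of y] by simp

text \<open>A minimizer repeated at all nodes is feasible with vanishing Laplacian terms, so its
  nonnegative gap gives one inequality. Conversely, \<open>xs\<close> is constant by consensus, so
  its common entry lies in every \<open>Xi i\<close>.\<close>

lemma saddle_value: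
  assumes lower: "\<And>y. y \<in> (\<Inter>i. Xi i) \<Longrightarrow> fstar \<le> (\<Sum>i\<in>UNIV. f i y)"
    and attained: "y \<in> (\<Inter>i. Xi i)" "(\<Sum>i\<in>UNIV. f i y) = fstar"
  shows "separable_sum f xs = fstar"
proof (rule antisym)
  have "(\<chi> i. y) \<in> product_set Xi"
    using attained(1) by (simp add: product_set_def)
  then have "gap (\<chi> i. y) \<ge> 0"
    by (rule gap_nonneg)
  then show "separable_sum f xs \<le> fstar"
    using attained(2) by (simp add: gap_def laplacian_mult_constant[OF graph] separable_sum_def)
next
  fix i :: 'n
  have const: "xs $ j = xs $ i" for j
    using laplacian_kernel_constant[OF graph conn saddle_consensus] .
  then have "xs $ i \<in> (\<Inter>i. Xi i)"
    using saddle_mem by (simp add: product_set_def) metis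
  from lower[OF this] show "fstar \<le> separable_sum f xs"
    unfolding separable_sum_def by (subst const) simp
qed

lemma gap_lipschitz:
  obtains K where "K \<ge> 0"
    "\<And>y w. norm y \<le> R \<Longrightarrow> norm w \<le> R \<Longrightarrow> \<bar>gap y - gap w\<bar> \<le> K * norm (y - w)"
proof -
  have "\<exists>K\<ge>0. \<forall>u w. u \<in> cball 0 R \<longrightarrow> w \<in> cball 0 R \<longrightarrow> \<bar>f i u - f i w\<bar> \<le> K * norm (u - w)" for i
    using convex_on_lipschitz_cball[OF f_convex[of i]] by metis
  then obtain Kf where Kf0: "\<And>i. Kf i \<ge> 0" and Kf: "\<And>i u w. u \<in> cball 0 R \<Longrightarrow> w \<in> cball 0 R \<Longrightarrow>
      \<bar>f i u - f i w\<bar> \<le> Kf i * norm (u - w)"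
    by metis
  obtain KL where KL: "KL \<ge> 0" "\<And>x. norm (L *v x) \<le> KL * norm x"
    using norm_matrix_vector_le by metis
  \<comment> \<open>The absolute value keeps \<open>K\<close> nonnegative even for negative
    \<open>R\<close>, where the estimate is vacuous.\<close>
  define K where "K = (\<Sum>i\<in>UNIV. Kf i) + norm vs * KL + 2 * \<bar>R\<bar> * KL"
  show ?thesis
  proof (rule that)
    show "K \<ge> 0"
      unfolding K_def using Kf0 KL(1) by (auto intro!: add_nonneg_nonneg sum_nonneg)
    fix y w :: "real ^ 'n"
    assume y: "norm y \<le> R" and w: "norm w \<le> R"
    have comp: "z $ i \<in> cball 0 R" if "norm z \<le> R" for z :: "real ^ 'n" and i
      using component_le_norm_cart[of z i] that by simp
    have "\<bar>f i (y $ i) - f i (w $ i)\<bar> \<le> Kf i * norm (y - w)" for i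
    proof -
      have "\<bar>f i (y $ i) - f i (w $ i)\<bar> \<le> Kf i * norm (y $ i - w $ i)"
        by (intro Kf comp y w)
      also have "\<dots> \<le> Kf i * norm (y - w)"
        using component_le_norm_cart[of "y - w" i] Kf0[of i] by (intro mult_left_mono) auto
      finally show ?thesis .
    qed
    then have "\<bar>\<Sum>i\<in>UNIV. f i (y $ i) - f i (w $ i)\<bar> \<le> (\<Sum>i\<in>UNIV. Kf i * norm (y - w))"
      by (intro order_trans[OF sum_abs] sum_mono)
    then have 1: "\<bar>separable_sum f y - separable_sum f w\<bar> \<le> (\<Sum>i\<in>UNIV. Kf i) * norm (y - w)"
      by (simp add: separable_sum_def sum_subtractf sum_distrib_right)
    have inner_le: "\<bar>u \<bullet> (L *v z)\<bar> \<le> norm u * KL * norm z" for u z :: "real ^ 'n"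
      using order_trans[OF Cauchy_Schwarz_ineq2 mult_left_mono[OF KL(2) norm_ge_zero], of u z]
      by (simp add: mult_ac)
    have 2: "\<bar>vs \<bullet> (L *v y) - vs \<bullet> (L *v w)\<bar> \<le> norm vs * KL * norm (y - w)"
      using inner_le[of vs "y - w"] by (simp add: matrix_vector_mult_diff_distrib inner_diff_right)
    \<comment> \<open>Symmetry of \<open>L\<close> factors the difference of the two quadratic
      forms, which exposes the factor \<open>y - w\<close>.\<close>
    have "y \<bullet> (L *v y) - w \<bullet> (L *v w) = (y + w) \<bullet> (L *v (y - w))"
      using inner_laplacian_commute[OF graph, of y w]
      by (simp add: matrix_vector_mult_diff_distrib inner_diff_right inner_add_left)
    also have "\<bar>\<dots>\<bar> \<le> norm (y + w) * KL * norm (y - w)"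
      by (rule inner_le)
    also have "\<dots> \<le> 2 * \<bar>R\<bar> * KL * norm (y - w)"
      using norm_triangle_ineq[of y w] y w KL(1) by (intro mult_right_mono) auto
    finally have 3: "\<bar>y \<bullet> (L *v y) - w \<bullet> (L *v w)\<bar> \<le> 2 * \<bar>R\<bar> * KL * norm (y - w)" .
    show "\<bar>gap y - gap w\<bar> \<le> K * norm (y - w)"
      using 1 2 3 by (simp add: gap_def K_def distrib_right)
  qed
qed

lemma continuous_separable_sum: "continuous_on UNIV (separable_sum f)"
proof -
  have "continuous_on UNIV (\<lambda>y :: real ^ 'n. f i (y $ i))" for i
    by (rule continuous_on_compose2[OF convex_on_continuous[OF open_UNIV f_convex[of i]]])
      (auto intro: continuous_intros)
  then show ?thesis
    unfolding separable_sum_def[abs_def] by (intro continuous_on_sum) auto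
qed

text \<open>The left-hand side is the inner product of all stacked directions with the vector from
  the saddle point to \<open>(y, w)\<close>. The subgradient inequalities are tested at
  \<open>xs\<close>, losing \<open>e\<close> per node; by symmetry of \<open>L\<close> the terms
  coupling \<open>y\<close> and \<open>w\<close> cancel, and those with \<open>xs\<close> vanish
  because \<open>L *v xs = 0\<close>.\<close>

lemma direction_inner_ge:
  fixes e :: real
  assumes g: "\<And>i. g i \<in> eps_subdifferential (f i) e (y $ i)"
  shows "(\<Sum>i\<in>UNIV. (g i + disagreement a y i + disagreement a w i) * (y $ i - xs $ i)
      - disagreement a y i * (w $ i - vs $ i)) \<ge> gap y - CARD('n) * e"
proof -
  have "f i (xs $ i) \<ge> f i (y $ i) + g i * (xs $ i - y $ i) - e" for i
    using g[of i] by (simp add: eps_subdifferential_def)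
  then have "f i (y $ i) - f i (xs $ i) - e \<le> g i * (y $ i - xs $ i)" for i
    by (simp add: algebra_simps)
  then have "(\<Sum>i\<in>UNIV. f i (y $ i) - f i (xs $ i) - e) \<le> (\<Sum>i\<in>UNIV. g i * (y $ i - xs $ i))"
    by (rule sum_mono)
  then have 1: "(\<Sum>i\<in>UNIV. g i * (y $ i - xs $ i))
      \<ge> separable_sum f y - separable_sum f xs - CARD('n) * e"
    by (simp add: separable_sum_def sum_subtractf)
  have sum_eq: "(\<Sum>i\<in>UNIV. disagreement a z i * (u $ i - t $ i)) = (u - t) \<bullet> (L *v z)" for u t z
    by (simp add: inner_laplacian[OF graph] mult.commute)
  have "(\<Sum>i\<in>UNIV. (g i + disagreement a y i + disagreement a w i) * (y $ i - xs $ i)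
      - disagreement a y i * (w $ i - vs $ i))
    = (\<Sum>i\<in>UNIV. g i * (y $ i - xs $ i)) + (y - xs) \<bullet> (L *v y) + (y - xs) \<bullet> (L *v w)
      - (w - vs) \<bullet> (L *v y)"
    unfolding sum_eq[symmetric] by (simp add: sum.distrib[symmetric] sum_subtractf[symmetric] algebra_simps)
  also have "\<dots> = (\<Sum>i\<in>UNIV. g i * (y $ i - xs $ i)) + y \<bullet> (L *v y) + vs \<bullet> (L *v y)"
    using inner_laplacian_commute[OF graph, of xs] inner_laplacian_commute[OF graph, of y w]
    by (simp add: saddle_consensus inner_diff_left)
  finally show ?thesis
    using 1 by (simp add: gap_def)
qed

end

text \<open>Unlike in the theorem, all iterates are feasible and all nodes use the same normalizer \<open>M k\<close>.\<close>

locale primal_dual_iteration = primal_dual_saddle f Xi a xs vs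
  for f :: "'n::finite \<Rightarrow> real \<Rightarrow> real" and Xi :: "'n \<Rightarrow> real set"
    and a :: "'n \<Rightarrow> 'n \<Rightarrow> real" and xs vs :: "real ^ 'n" +
  fixes \<alpha> \<epsilon> M :: "nat \<Rightarrow> real" and c :: real and g :: "'n \<Rightarrow> nat \<Rightarrow> real"
    and x v :: "nat \<Rightarrow> real ^ 'n"
  assumes c_pos: "c > 0" and \<alpha>_pos: "\<And>k. \<alpha> k > 0" and \<epsilon>_pos: "\<And>k. \<epsilon> k > 0"
    and \<alpha>_diverges: "\<not> summable \<alpha>" and \<alpha>_square: "summable (\<lambda>k. (\<alpha> k)\<^sup>2)"
    and \<alpha>_\<epsilon>: "summable (\<lambda>k. \<alpha> k * \<epsilon> k)"
    and g_subgrad: "\<And>i k. g i k \<in> eps_subdifferential (f i) (\<epsilon> k) (x k $ i)"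
    and M: "\<And>k. M k = Max (range (\<lambda>i. norm (direction a (g i k) (x k) (v k) i)))"
    and x_mem: "\<And>k. x k \<in> product_set Xi"
    and x_step: "\<And>i k. x (Suc k) $ i = closest_point (Xi i)
          (x k $ i - \<alpha> k / max c (M k)
             * (g i k + disagreement a (x k) i + disagreement a (v k) i))"
    and v_step: "\<And>i k. v (Suc k) $ i = v k $ i + \<alpha> k / max c (M k) * disagreement a (x k) i"
begin

section \<open>Normalized step sizes and the length of one move\<close>

definition \<gamma> :: "nat \<Rightarrow> real" where "\<gamma> k = \<alpha> k / max c (M k)"

lemma \<gamma>_pos: "\<gamma> k > 0"
  using \<alpha>_pos[of k] c_pos by (simp add: \<gamma>_def)

lemma \<gamma>_le: "\<gamma> k \<le> \<alpha> k / c"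
  unfolding \<gamma>_def using \<alpha>_pos[of k] c_pos by (intro divide_left_mono) auto

text \<open>This is the purpose of the normalization: before projection no node moves by more than
  \<open>\<alpha> k\<close>, however large its subgradient is.\<close>

lemma \<gamma>_M_le: "\<gamma> k * M k \<le> \<alpha> k"
proof -
  have "\<gamma> k * M k \<le> \<gamma> k * max c (M k)"
    using \<gamma>_pos[of k] by (intro mult_left_mono) auto
  also have "\<dots> = \<alpha> k"
    using c_pos by (simp add: \<gamma>_def)
  finally show ?thesis .
qed

lemma norm_direction_le: "norm (direction a (g i k) (x k) (v k) i) \<le> M k"
  by (simp add: M)

lemma M_nonneg: "M k \<ge> 0"
  using norm_direction_le order_trans[OF norm_ge_zero] by blast

lemma closest_point_dist:
  assumes "s \<in> Xi i"
  shows "\<bar>closest_point (Xi i) r - s\<bar> \<le> \<bar>r - s\<bar>"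
  using closest_point_lipschitz[OF X_convex X_closed, of i r s] closest_point_self[OF assms] assms
  by (auto simp: dist_real_def)

text \<open>The feasible \<open>x k\<close> is fixed by the projections, so nonexpansiveness bounds
  each component by the unprojected move. The factor \<open>CARD('n)\<close> comes from passing
  through the 1-norm.\<close>

lemma x_increment: "norm (x (Suc k) - x k) \<le> CARD('n) * (\<gamma> k * M k)"
proof -
  have "\<bar>(x (Suc k) - x k) $ i\<bar> \<le> \<gamma> k * M k" for i
  proof -
    let ?w = "g i k + disagreement a (x k) i + disagreement a (v k) i"
    have "\<bar>(x (Suc k) - x k) $ i\<bar> \<le> \<bar>\<gamma> k * ?w\<bar>"
      using closest_point_dist[of "x k $ i" i "x k $ i - \<gamma> k * ?w"] x_mem[of k]
      by (simp add: x_step \<gamma>_def product_set_def)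
    also have "\<dots> = \<gamma> k * \<bar>?w\<bar>"
      using \<gamma>_pos[of k] by (simp add: abs_mult)
    also have "\<dots> \<le> \<gamma> k * M k"
      using \<gamma>_pos[of k] order_trans[OF norm_fst_le norm_direction_le[of i k, unfolded direction_def]]
      by (intro mult_left_mono) auto
    finally show ?thesis .
  qed
  then have "(\<Sum>i\<in>UNIV. \<bar>(x (Suc k) - x k) $ i\<bar>) \<le> (\<Sum>i\<in>(UNIV::'n set). \<gamma> k * M k)"
    by (intro sum_mono)
  then show ?thesis
    using norm_le_l1_cart[of "x (Suc k) - x k"] by simp
qed

section \<open>Quasi-Fejer monotonicity with respect to the saddle point\<close>

definition z_dist :: "nat \<Rightarrow> real" where "z_dist k = norm ((x k, v k) - (xs, vs))"

text \<open>Each node's square is expanded after the projection has been removed by nonexpansiveness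
  towards \<open>xs\<close>. Since all nodes share one step size, \<open>\<gamma> k\<close> factors
  out of the sum and \<open>direction_inner_ge\<close> bounds the linear term.\<close>

lemma z_dist_step:
  "(z_dist (Suc k))\<^sup>2 \<le> (z_dist k)\<^sup>2 - 2 * (\<gamma> k * gap (x k))
    + (2 * CARD('n) / c * (\<alpha> k * \<epsilon> k) + CARD('n) * (\<alpha> k)\<^sup>2)"
proof -
  define w where "w i = g i k + disagreement a (x k) i + disagreement a (v k) i" for i
  define d where "d i = disagreement a (x k) i" for i
  have node: "(x (Suc k) $ i - xs $ i)\<^sup>2 + (v (Suc k) $ i - vs $ i)\<^sup>2
    \<le> (x k $ i - xs $ i)\<^sup>2 + (v k $ i - vs $ i)\<^sup>2
      - 2 * \<gamma> k * (w i * (x k $ i - xs $ i) - d i * (v k $ i - vs $ i)) + (\<alpha> k)\<^sup>2" for i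
  proof -
    have "\<bar>x (Suc k) $ i - xs $ i\<bar> \<le> \<bar>x k $ i - \<gamma> k * w i - xs $ i\<bar>"
      using closest_point_dist[of "xs $ i" i] saddle_mem
      by (simp add: x_step \<gamma>_def w_def product_set_def)
    then have "(x (Suc k) $ i - xs $ i)\<^sup>2 \<le> (x k $ i - \<gamma> k * w i - xs $ i)\<^sup>2"
      by (simp add: abs_le_square_iff)
    moreover have "v (Suc k) $ i = v k $ i + \<gamma> k * d i"
      by (simp add: v_step \<gamma>_def d_def)
    \<comment> \<open>The second-order term is the squared length of the unprojected move of node
      \<open>i\<close>.\<close>
    moreover have "(\<gamma> k)\<^sup>2 * ((w i)\<^sup>2 + (d i)\<^sup>2) \<le> (\<alpha> k)\<^sup>2"
    proof -
      have "(w i)\<^sup>2 + (d i)\<^sup>2 = (norm (direction a (g i k) (x k) (v k) i))\<^sup>2"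
        by (simp add: direction_def w_def d_def norm_Pair)
      also have "\<dots> \<le> (M k)\<^sup>2"
        by (intro power_mono norm_direction_le) auto
      finally have "(\<gamma> k)\<^sup>2 * ((w i)\<^sup>2 + (d i)\<^sup>2) \<le> (\<gamma> k * M k)\<^sup>2"
        unfolding power_mult_distrib by (intro mult_left_mono) auto
      also have "\<dots> \<le> (\<alpha> k)\<^sup>2"
        using \<gamma>_M_le \<gamma>_pos[of k] M_nonneg by (intro power_mono) auto
      finally show ?thesis .
    qed
    ultimately show ?thesis
      by (simp add: power2_eq_square algebra_simps)
  qed
  have "(z_dist (Suc k))\<^sup>2 \<le> (\<Sum>i\<in>UNIV. (x k $ i - xs $ i)\<^sup>2 + (v k $ i - vs $ i)\<^sup>2
      - 2 * \<gamma> k * (w i * (x k $ i - xs $ i) - d i * (v k $ i - vs $ i)) + (\<alpha> k)\<^sup>2)"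
    unfolding z_dist_def norm_pair_diff_sq by (intro sum_mono node)
  also have "\<dots> = (z_dist k)\<^sup>2
      - 2 * \<gamma> k * (\<Sum>i\<in>UNIV. w i * (x k $ i - xs $ i) - d i * (v k $ i - vs $ i))
      + CARD('n) * (\<alpha> k)\<^sup>2"
    unfolding z_dist_def norm_pair_diff_sq
    by (simp only: sum.distrib sum_subtractf sum_distrib_left[symmetric]) simp
  also have "\<dots> \<le> (z_dist k)\<^sup>2 - 2 * \<gamma> k * (gap (x k) - CARD('n) * \<epsilon> k) + CARD('n) * (\<alpha> k)\<^sup>2"
    using mult_left_mono[OF direction_inner_ge[of "\<lambda>i. g i k" "\<epsilon> k" "x k" "v k", OF g_subgrad],
        of "2 * \<gamma> k"] \<gamma>_pos[of k]
    unfolding w_def d_def by linarith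
  \<comment> \<open>Replacing \<open>\<gamma> k\<close> by \<open>\<alpha> k / c\<close> in the
    subgradient error makes that error summable.\<close>
  also have "\<dots> \<le> (z_dist k)\<^sup>2 - 2 * (\<gamma> k * gap (x k))
    + (2 * CARD('n) / c * (\<alpha> k * \<epsilon> k) + CARD('n) * (\<alpha> k)\<^sup>2)"
    using mult_right_mono[OF \<gamma>_le[of k], of "2 * CARD('n) * \<epsilon> k"] \<epsilon>_pos[of k]
    by (simp add: algebra_simps)
  finally show ?thesis .
qed

lemma fejer:
  shows convergent_z_dist: "convergent z_dist"
    and summable_\<gamma>_gap: "summable (\<lambda>k. \<gamma> k * gap (x k))"
proof -
  let ?q = "\<lambda>k. 2 * CARD('n) / c * (\<alpha> k * \<epsilon> k) + CARD('n) * (\<alpha> k)\<^sup>2"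
  have q: "?q k \<ge> 0" for k
    using \<alpha>_pos[of k] \<epsilon>_pos[of k] c_pos by simp
  have q_sum: "summable ?q"
    by (intro summable_add summable_mult \<alpha>_\<epsilon> \<alpha>_square)
  have p: "2 * (\<gamma> k * gap (x k)) \<ge> 0" for k
    using \<gamma>_pos[of k] gap_nonneg[OF x_mem] by simp
  have "convergent (\<lambda>k. (z_dist k)\<^sup>2)"
    using quasi_fejer(1)[of "\<lambda>k. (z_dist k)\<^sup>2", OF z_dist_step _ p q q_sum] by simp
  then obtain l where "(\<lambda>k. (z_dist k)\<^sup>2) \<longlonglongrightarrow> l"
    by (auto simp: convergent_def)
  from tendsto_real_sqrt[OF this] show "convergent z_dist"
    unfolding convergent_def by (simp add: z_dist_def[abs_def]) blast
  have "summable (\<lambda>k. 2 * (\<gamma> k * gap (x k)))"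
    using quasi_fejer(2)[of "\<lambda>k. (z_dist k)\<^sup>2", OF z_dist_step _ p q q_sum] by simp
  then show "summable (\<lambda>k. \<gamma> k * gap (x k))"
    by (simp add: summable_cmult_iff)
qed

section \<open>Bounded iterates and non-summable normalized step sizes\<close>

lemma bounded_iterates: obtains R where "R \<ge> 0" "\<And>k. norm (x k, v k) \<le> R"
proof -
  obtain B where B: "\<And>k. \<bar>z_dist k\<bar> \<le> B"
    using convergent_imp_Bseq[OF convergent_z_dist] by (auto simp: Bseq_def)
  have "norm (x k, v k) \<le> B + norm (xs, vs)" for k
    using norm_triangle_sub[of "(x k, v k)" "(xs, vs)"] B[of k] by (simp add: z_dist_def)
  moreover have "B + norm (xs, vs) \<ge> 0"
    using order_trans[OF abs_ge_zero B] by simp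
  ultimately show ?thesis using that by blast
qed

lemma M_le:
  obtains C where "C \<ge> c" "\<And>k. M k \<le> C * (1 + \<epsilon> k)"
proof -
  obtain R where R: "R \<ge> 0" "\<And>k. norm (x k, v k) \<le> R"
    using bounded_iterates by blast
  have xR: "norm (x k) \<le> R" and vR: "norm (v k) \<le> R" for k
    using order_trans[OF norm_fst_le R(2)] order_trans[OF norm_snd_le R(2)] by auto
  have "\<exists>K\<ge>0. \<forall>u e h. u \<in> cball 0 R \<longrightarrow> e \<ge> 0 \<longrightarrow> h \<in> eps_subdifferential (f i) e u \<longrightarrow> norm h \<le> K + e"
    for i
    using eps_subdifferential_norm_le[OF f_convex[of i]] by metis
  then obtain Kf where Kf0: "\<And>i. Kf i \<ge> 0"
    and Kf: "\<And>i u e h. u \<in> cball 0 R \<Longrightarrow> e \<ge> 0 \<Longrightarrow> h \<in> eps_subdifferential (f i) e u \<Longrightarrow> norm h \<le> Kf i + e"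
    by metis
  obtain KL where KL: "KL \<ge> 0" "\<And>x. norm (L *v x) \<le> KL * norm x"
    using norm_matrix_vector_le by metis
  have dis: "\<bar>disagreement a y i\<bar> \<le> KL * R" if "norm y \<le> R" for y i
  proof -
    have "\<bar>disagreement a y i\<bar> \<le> norm (L *v y)"
      using component_le_norm_cart[of "L *v y" i] by (simp add: laplacian_mult_vec[OF graph])
    also have "\<dots> \<le> KL * R"
      using KL that by (meson order_trans mult_left_mono)
    finally show ?thesis .
  qed
  \<comment> \<open>Two disagreements enter the first component of a direction and one the second,
    hence the factor 3. The summands \<open>c\<close> and \<open>1\<close> ensure
    \<open>C \<ge> c\<close> and let \<open>C\<close> absorb the coefficient of
    \<open>\<epsilon> k\<close>.\<close>
  define C where "C = c + 1 + (\<Sum>i\<in>UNIV. Kf i) + 3 * (KL * R)"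
  have C: "C \<ge> c" "C \<ge> 1" "C \<ge> 1 + (\<Sum>i\<in>UNIV. Kf i) + 3 * (KL * R)"
    using Kf0 KL(1) R(1) c_pos sum_nonneg[of UNIV Kf] by (auto simp: C_def)
  have "norm (direction a (g i k) (x k) (v k) i) \<le> C * (1 + \<epsilon> k)" for i k
  proof -
    have "norm (direction a (g i k) (x k) (v k) i)
        \<le> \<bar>g i k + disagreement a (x k) i + disagreement a (v k) i\<bar> + \<bar>disagreement a (x k) i\<bar>"
      using norm_Pair_le[of "g i k + disagreement a (x k) i + disagreement a (v k) i"
          "- disagreement a (x k) i"] by (simp add: direction_def)
    also have "\<dots> \<le> \<bar>g i k\<bar> + 3 * (KL * R)"
      using dis[OF xR[of k], of i] dis[OF vR[of k], of i] by linarith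
    also have "\<bar>g i k\<bar> \<le> Kf i + \<epsilon> k"
      using Kf[of "x k $ i" "\<epsilon> k" "g i k" i] g_subgrad[of i k] \<epsilon>_pos[of k]
        order_trans[OF component_le_norm_cart xR[of k], of i] by simp
    also have "Kf i \<le> (\<Sum>i\<in>UNIV. Kf i)"
      using Kf0 by (intro member_le_sum) auto
    finally have "norm (direction a (g i k) (x k) (v k) i) \<le> C + 1 * \<epsilon> k"
      using C(3) by simp
    also have "\<dots> \<le> C + C * \<epsilon> k"
      using C(2) \<epsilon>_pos[of k] by (intro add_left_mono mult_right_mono) auto
    finally show ?thesis by (simp add: distrib_left)
  qed
  then have "M k \<le> C * (1 + \<epsilon> k)" for k
    unfolding M by (intro Max.boundedI) auto
  with C(1) show ?thesis using that by blast
qed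

text \<open>The errors \<open>\<epsilon> k\<close>, and with them the normalizers \<open>M k\<close>, may be unbounded; the summability
  of \<open>\<alpha> k * \<epsilon> k\<close> keeps the normalized step sizes from becoming summable.\<close>

lemma not_summable_\<gamma>: "\<not> summable \<gamma>"
proof
  assume \<gamma>: "summable \<gamma>"
  obtain C where C: "C \<ge> c" "\<And>k. M k \<le> C * (1 + \<epsilon> k)"
    using M_le by blast
  \<comment> \<open>The normalization is undone: \<open>\<alpha> k\<close> is
    \<open>\<gamma> k\<close> times a normalizer of at most \<open>C * (1 + \<epsilon> k)\<close>,
    and the part with \<open>\<epsilon> k\<close> is estimated by
    \<open>\<gamma> k \<le> \<alpha> k / c\<close>.\<close>
  have "\<alpha> k \<le> C * \<gamma> k + C / c * (\<alpha> k * \<epsilon> k)" for k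
  proof -
    have "max c (M k) \<le> C * (1 + \<epsilon> k)"
    proof -
      have "0 \<le> C * \<epsilon> k"
        using C(1) c_pos \<epsilon>_pos[of k] by simp
      then have "c \<le> C * (1 + \<epsilon> k)"
        using C(1) by (simp add: distrib_left)
      with C(2)[of k] show ?thesis by simp
    qed
    moreover have "\<alpha> k = \<gamma> k * max c (M k)"
      using c_pos by (simp add: \<gamma>_def)
    ultimately have "\<alpha> k \<le> \<gamma> k * (C * (1 + \<epsilon> k))"
      using \<gamma>_pos[of k] by (simp add: mult_left_mono)
    moreover have "C * \<epsilon> k * \<gamma> k \<le> C * \<epsilon> k * (\<alpha> k / c)"
      using \<gamma>_le[of k] C(1) c_pos \<epsilon>_pos[of k] by (intro mult_left_mono) auto
    ultimately show ?thesis
      by (simp add: algebra_simps)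
  qed
  moreover have "summable (\<lambda>k. C * \<gamma> k + C / c * (\<alpha> k * \<epsilon> k))"
    by (intro summable_add summable_mult \<gamma> \<alpha>_\<epsilon>)
  ultimately have "summable \<alpha>"
    using \<alpha>_pos by (intro summable_comparison_test'[where f = \<alpha> and N = 0]) (auto simp: less_imp_le)
  with \<alpha>_diverges show False by simp
qed

text \<open>Lipschitz continuity on the bounded set of iterates turns the moves of \<open>x\<close>
  into increments of the gap. The product \<open>\<gamma> k * M k\<close> is then estimated in two
  ways, once for the increments and once for their squares.\<close>

lemma gap_tendsto_zero: "(\<lambda>k. gap (x k)) \<longlonglongrightarrow> 0"
proof -
  obtain R where R: "R \<ge> 0" "\<And>k. norm (x k, v k) \<le> R"
    using bounded_iterates by blast
  have xR: "norm (x k) \<le> R" for k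
    using order_trans[OF norm_fst_le R(2)] by auto
  obtain K where K: "K \<ge> 0"
    "\<And>y w. norm y \<le> R \<Longrightarrow> norm w \<le> R \<Longrightarrow> \<bar>gap y - gap w\<bar> \<le> K * norm (y - w)"
    using gap_lipschitz by blast
  obtain C where C: "C \<ge> c" "\<And>k. M k \<le> C * (1 + \<epsilon> k)"
    using M_le by blast
  define K' where "K' = K * CARD('n)"
  have K': "K' \<ge> 0"
    using K(1) by (simp add: K'_def)
  have incr: "\<bar>gap (x (Suc k)) - gap (x k)\<bar> \<le> K' * (\<gamma> k * M k)" for k
    using order_trans[OF K(2)[OF xR xR] mult_left_mono[OF x_increment K(1)]]
    by (simp add: K'_def mult.assoc)
  show ?thesis
  proof (rule tendsto_zero_of_summable_weighted)
    show "gap (x k) \<ge> 0" for k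
      by (rule gap_nonneg[OF x_mem])
    \<comment> \<open>The zero vector serves as reference point in the ball of radius
      \<open>R\<close>.\<close>
    show "gap (x k) \<le> \<bar>gap 0\<bar> + K * R" for k
      using K(2)[OF xR, of 0 k] mult_left_mono[OF xR[of k] K(1)] R(1) by simp
    show "\<gamma> k \<ge> 0" for k
      using \<gamma>_pos[of k] by simp
    \<comment> \<open>The bound \<open>M k \<le> C * (1 + \<epsilon> k)\<close> is used here: the
      increment must be of order \<open>\<gamma> k\<close> up to a summable term, and a bound by
      \<open>\<alpha> k\<close> would not show this.\<close>
    show "\<bar>gap (x (Suc k)) - gap (x k)\<bar> \<le> (K' * C) * \<gamma> k + K' * C / c * (\<alpha> k * \<epsilon> k)" for k
    proof -
      have "\<gamma> k * M k \<le> \<gamma> k * (C * (1 + \<epsilon> k))"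
        using C(2)[of k] \<gamma>_pos[of k] by (intro mult_left_mono) auto
      moreover have "C * \<epsilon> k * \<gamma> k \<le> C * \<epsilon> k * (\<alpha> k / c)"
        using \<gamma>_le[of k] C(1) c_pos \<epsilon>_pos[of k] by (intro mult_left_mono) auto
      ultimately have "\<gamma> k * M k \<le> C * \<gamma> k + C / c * (\<alpha> k * \<epsilon> k)"
        by (simp add: algebra_simps)
      from order_trans[OF incr mult_left_mono[OF this K']] show ?thesis
        by (simp add: algebra_simps)
    qed
    show "K' * C / c * (\<alpha> k * \<epsilon> k) \<ge> 0" for k
      using K' C(1) c_pos \<alpha>_pos[of k] \<epsilon>_pos[of k] by simp
    \<comment> \<open>For the squares \<open>\<gamma> k * M k \<le> \<alpha> k\<close> is the
      suitable estimate, as the squares of \<open>\<alpha>\<close> are summable.\<close>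
    show "summable (\<lambda>k. (gap (x (Suc k)) - gap (x k))\<^sup>2)"
    proof (rule summable_comparison_test'[where N = 0])
      show "summable (\<lambda>k. K'\<^sup>2 * (\<alpha> k)\<^sup>2)"
        by (intro summable_mult \<alpha>_square)
      show "norm ((gap (x (Suc k)) - gap (x k))\<^sup>2) \<le> K'\<^sup>2 * (\<alpha> k)\<^sup>2" for k
        using power_mono[OF order_trans[OF incr mult_left_mono[OF \<gamma>_M_le K']] abs_ge_zero, of k 2]
        by (simp add: power_mult_distrib)
    qed
  qed (use not_summable_\<gamma> summable_\<gamma>_gap \<alpha>_\<epsilon> in \<open>auto intro!: summable_mult\<close>)
qed

section \<open>Consensus, objective values and cluster points\<close>

lemma laplacian_form_tendsto_zero: "(\<lambda>k. x k \<bullet> (L *v x k)) \<longlonglongrightarrow> 0"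
proof (rule tendsto_0_le[OF gap_tendsto_zero, where K = 2], intro always_eventually allI)
  show "norm (x k \<bullet> (L *v x k)) \<le> norm (gap (x k)) * 2" for k
    using gap_ge[OF x_mem[of k]] laplacian_form_nonneg[OF graph, of "x k"] by simp
qed

lemma consensus: "(\<lambda>k. x k $ i - x k $ j) \<longlonglongrightarrow> 0"
  by (rule consensus_of_laplacian_form[OF graph conn laplacian_form_tendsto_zero])

text \<open>Consensus makes the linear and the quadratic Laplacian terms of the gap vanish, so its
  remaining part, the difference of objective values, tends to zero too.\<close>

lemma separable_sum_tendsto: "(\<lambda>k. separable_sum f (x k)) \<longlonglongrightarrow> separable_sum f xs"
proof -
  have "(\<lambda>k. disagreement a (x k) i) \<longlonglongrightarrow> 0" for i
    unfolding disagreement_def by (intro tendsto_null_sum tendsto_mult_right_zero consensus)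
  then have "(\<lambda>k. vs \<bullet> (L *v x k)) \<longlonglongrightarrow> 0"
    unfolding inner_laplacian[OF graph] by (intro tendsto_null_sum tendsto_mult_right_zero)
  from tendsto_diff[OF tendsto_diff[OF gap_tendsto_zero this] laplacian_form_tendsto_zero]
  have "(\<lambda>k. separable_sum f (x k) - separable_sum f xs) \<longlonglongrightarrow> 0"
    by (simp add: gap_def)
  then show ?thesis
    by (simp add: LIM_zero_iff)
qed

text \<open>Consensus, closedness of the sets and continuity of the objective pass to the limit
  along the subsequence.\<close>

lemma cluster_consensus:
  assumes "strict_mono r" and lim: "(\<lambda>k. x (r k)) \<longlonglongrightarrow> xbar"
  obtains y where "xbar = (\<chi> i. y)" "y \<in> (\<Inter>i. Xi i)" "(\<Sum>i\<in>UNIV. f i y) = separable_sum f xs"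
proof -
  have comp: "(\<lambda>k. x (r k) $ i) \<longlonglongrightarrow> xbar $ i" for i
    by (intro tendsto_vec_nth lim)
  have "xbar $ i - xbar $ j = 0" for i j
  proof (rule LIMSEQ_unique)
    show "(\<lambda>k. x (r k) $ i - x (r k) $ j) \<longlonglongrightarrow> xbar $ i - xbar $ j"
      by (intro tendsto_diff comp)
    show "(\<lambda>k. x (r k) $ i - x (r k) $ j) \<longlonglongrightarrow> 0"
      using LIMSEQ_subseq_LIMSEQ[OF consensus assms(1)] by (simp add: o_def)
  qed
  then obtain y where y: "\<And>i. xbar $ i = y"
    by (metis eq_iff_diff_eq_0)
  have "y \<in> Xi i" for i
    using closed_sequentially[OF X_closed[of i] _ comp[of i]] x_mem y by (simp add: product_set_def)
  moreover have "separable_sum f xbar = separable_sum f xs"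
  proof (rule LIMSEQ_unique)
    show "(\<lambda>k. separable_sum f (x (r k))) \<longlonglongrightarrow> separable_sum f xbar"
      using continuous_on_tendsto_compose[OF continuous_separable_sum lim] by simp
    show "(\<lambda>k. separable_sum f (x (r k))) \<longlonglongrightarrow> separable_sum f xs"
      using LIMSEQ_subseq_LIMSEQ[OF separable_sum_tendsto assms(1)] by (simp add: o_def)
  qed
  ultimately show ?thesis
    using y that[of y] by (simp add: separable_sum_def vec_eq_iff)
qed

text \<open>The reindexing \<open>r\<close> serves two uses: the identity for the existence of a
  cluster point, and a subsequence bounded away from a presumed limit.\<close>

lemma convergent_subsequence:
  fixes r :: "nat \<Rightarrow> nat"
  obtains s xbar vbar where "strict_mono s" "(\<lambda>k. (x (r (s k)), v (r (s k)))) \<longlonglongrightarrow> (xbar, vbar)"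
proof -
  obtain R where "\<And>k. norm (x k, v k) \<le> R"
    using bounded_iterates by blast
  then have "bounded (range (\<lambda>k. (x (r k), v (r k))))"
    by (intro boundedI[where B = R]) auto
  from bounded_imp_convergent_subsequence[OF this]
  obtain l s where s: "strict_mono s" "((\<lambda>k. (x (r k), v (r k))) \<circ> s) \<longlonglongrightarrow> l"
    by blast
  show ?thesis
    by (rule that[of s "fst l" "snd l"]) (use s in \<open>simp_all add: o_def\<close>)
qed

text \<open>Otherwise a subsequence stays at distance \<open>e\<close> from the constant vector. By
  boundedness it has a cluster point, which must be that very vector.\<close>

lemma tendsto_unique_minimizer:
  assumes unique: "\<And>y'. y' \<in> (\<Inter>i. Xi i) \<Longrightarrow> (\<Sum>i\<in>UNIV. f i y') = separable_sum f xs \<Longrightarrow> y' = y"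
  shows "(\<lambda>k. x k $ i) \<longlonglongrightarrow> y"
proof -
  have "x \<longlonglongrightarrow> (\<chi> i. y)"
  proof (rule ccontr)
    assume "\<not> ?thesis"
    then obtain e where e: "e > 0" and "\<exists>\<^sub>F k in sequentially. dist (x k) (\<chi> i. y) \<ge> e"
      by (auto simp: tendsto_iff not_eventually not_less)
    then have "infinite {k. dist (x k) (\<chi> i. y) \<ge> e}"
      by (simp add: frequently_sequentially infinite_nat_iff_unbounded_le)
    from infinite_enumerate[OF this] obtain r :: "nat \<Rightarrow> nat"
      where r: "strict_mono r" "\<And>k. dist (x (r k)) (\<chi> i. y) \<ge> e"
      by auto
    obtain s xbar vbar where s: "strict_mono s"
      and lim: "(\<lambda>k. (x (r (s k)), v (r (s k)))) \<longlonglongrightarrow> (xbar, vbar)"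
      using convergent_subsequence by blast
    have limx: "(\<lambda>k. x (r (s k))) \<longlonglongrightarrow> xbar"
      using tendsto_fst[OF lim] by simp
    have "strict_mono (\<lambda>k. r (s k))"
      using r(1) s by (simp add: strict_mono_def)
    then obtain y' where "xbar = (\<chi> i. y')" "y' \<in> (\<Inter>i. Xi i)"
      "(\<Sum>i\<in>UNIV. f i y') = separable_sum f xs"
      using cluster_consensus[OF _ limx] by blast
    then have "xbar = (\<chi> i. y)"
      using unique[of y'] by simp
    with limx e have "\<forall>\<^sub>F k in sequentially. dist (x (r (s k))) (\<chi> i. y) < e"
      by (simp add: tendsto_iff)
    then obtain k where "dist (x (r (s k))) (\<chi> i. y) < e"
      by (auto simp: eventually_sequentially)
    with r(2)[of "s k"] show False by simp
  qed
  from tendsto_vec_nth[OF this, of i] show ?thesis by simp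
qed

end

section \<open>Transfer to the distributed algorithm with arbitrary initial values\<close>

theorem corollary1:
  fixes f :: "'n::finite \<Rightarrow> real \<Rightarrow> real"
    and Xi :: "'n \<Rightarrow> real set"
    and X Xstar :: "real set"
    and fstar c :: real
    and a :: "'n \<Rightarrow> 'n \<Rightarrow> real"
    and D :: nat
    and \<alpha> \<epsilon> :: "nat \<Rightarrow> real"
    and x v :: "nat \<Rightarrow> real ^ 'n"
    and g :: "'n \<Rightarrow> nat \<Rightarrow> real"
    and \<delta> :: "'n \<Rightarrow> nat \<Rightarrow> nat \<Rightarrow> real"
    and xs vs :: "real ^ 'n"
  assumes f_convex: "\<And>i. convex_on UNIV (f i)"
    and X_closed: "\<And>i. closed (Xi i)"
    and X_convex: "\<And>i. convex (Xi i)"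
    and X_def: "X = (\<Inter>i. Xi i)"
    and X_interior: "interior X \<noteq> {}"
    and fstar_lower: "\<And>y. y \<in> X \<Longrightarrow> fstar \<le> (\<Sum>i\<in>UNIV. f i y)"
    and Xstar_def: "Xstar = {y \<in> X. (\<Sum>i\<in>UNIV. f i y) = fstar}"
    and Xstar_nonempty: "Xstar \<noteq> {}"
    and graph: "weighted_graph a"
    and conn: "connected_graph a"
    and D_ge: "D \<ge> graph_diameter a + 1"
    and c_pos: "c > 0"
    and \<alpha>_pos: "\<And>k. k \<ge> 1 \<Longrightarrow> \<alpha> k > 0"
    and \<epsilon>_pos: "\<And>k. k \<ge> 1 \<Longrightarrow> \<epsilon> k > 0"
    and \<alpha>_diverges: "filterlim (\<lambda>n. \<Sum>k=1..n. \<alpha> k) at_top sequentially"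
    and \<alpha>_square: "summable (\<lambda>k. (\<alpha> (Suc k))\<^sup>2)"
    and \<alpha>_\<epsilon>: "summable (\<lambda>k. \<alpha> (Suc k) * \<epsilon> (Suc k))"
    and g_subgrad: "\<And>i k. k \<ge> 1 \<Longrightarrow> g i k \<in> eps_subdifferential (f i) (\<epsilon> k) (x k $ i)"
    and \<delta>_1: "\<And>i k. k \<ge> 1 \<Longrightarrow> \<delta> i k 1 = norm (direction a (g i k) (x k) (v k) i)"
    and \<delta>_step: "\<And>i k m. k \<ge> 1 \<Longrightarrow> 2 \<le> m \<Longrightarrow> m \<le> D \<Longrightarrow>
        \<delta> i k m = Max (insert (\<delta> i k (m - 1)) ((\<lambda>j. \<delta> j k (m - 1)) ` neighbors a i))"
    and x_step: "\<And>i k. k \<ge> 1 \<Longrightarrow>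
        x (k + 1) $ i = closest_point (Xi i)
          (x k $ i - \<alpha> k / max c (\<delta> i k D)
             * (g i k + disagreement a (x k) i + disagreement a (v k) i))"
    and v_step: "\<And>i k. k \<ge> 1 \<Longrightarrow>
        v (k + 1) $ i = v k $ i + \<alpha> k / max c (\<delta> i k D) * disagreement a (x k) i"
    and saddle: "saddle_point (aug_lagrangian f a) (product_set Xi) UNIV xs vs"
  shows "convergent (\<lambda>k. norm ((x (k + 1), v (k + 1)) - (xs, vs)))
    \<and> ((\<forall>i j. (\<lambda>k. x k $ i - x k $ j) \<longlonglongrightarrow> 0)
        \<and> (\<lambda>k. separable_sum f (x k)) \<longlonglongrightarrow> separable_sum f xs
        \<and> separable_sum f xs = fstar)
    \<and> (\<exists>xbar vbar. cluster_point (\<lambda>k. (x k, v k)) (xbar, vbar)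
        \<and> (\<exists>y\<in>Xstar. xbar = (\<chi> i. y)))
    \<and> (\<forall>y. Xstar = {y} \<longrightarrow> (\<forall>i. (\<lambda>k. x k $ i) \<longlonglongrightarrow> y))"
proof -
  \<comment> \<open>A minimizer witnesses nonemptiness, which guarantees that
    \<open>closest_point\<close> lands in the set.\<close>
  have ne: "Xi i \<noteq> {}" for i
    using Xstar_nonempty by (auto simp: Xstar_def X_def)
  have x_feasible: "x (k + 1) \<in> product_set Xi" if "k \<ge> 1" for k
    using closest_point_in_set[OF X_closed ne] x_step[OF that] by (simp add: product_set_def)
  have \<delta>_D: "\<delta> i k D = Max (range (\<lambda>i. norm (direction a (g i k) (x k) (v k) i)))" if "k \<ge> 1" for i k
    using max_consensus[OF graph conn D_ge, of "\<lambda>i. \<delta> i k" i] \<delta>_step[OF that] \<delta>_1[OF that] by simp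
  have not_summable: "\<not> summable (\<lambda>k. \<alpha> (k + 2))"
  proof
    assume "summable (\<lambda>k. \<alpha> (k + 2))"
    then have "summable (\<lambda>k. \<alpha> (Suc k))"
      using summable_iff_shift[of "\<lambda>k. \<alpha> (Suc k)" 1] by simp
    from summable_LIMSEQ[OF this]
    have "(\<lambda>n. \<Sum>k=1..n. \<alpha> k) \<longlonglongrightarrow> (\<Sum>k. \<alpha> (Suc k))"
      by (simp add: sum.atLeast1_atMost_eq)
    with \<alpha>_diverges show False
      using not_tendsto_and_filterlim_at_infinity[OF sequentially_bot] filterlim_at_top_imp_at_infinity
      by blast
  qed
  \<comment> \<open>The initial value is arbitrary: \<open>x 2\<close> is the first iterate known to be feasible.\<close>
  interpret primal_dual_iteration f Xi a xs vs "\<lambda>k. \<alpha> (k + 2)" "\<lambda>k. \<epsilon> (k + 2)"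
    "\<lambda>k. Max (range (\<lambda>i. norm (direction a (g i (k + 2)) (x (k + 2)) (v (k + 2)) i)))" c
    "\<lambda>i k. g i (k + 2)" "\<lambda>k. x (k + 2)" "\<lambda>k. v (k + 2)"
  proof unfold_locales
    show "summable (\<lambda>k. (\<alpha> (k + 2))\<^sup>2)" "summable (\<lambda>k. \<alpha> (k + 2) * \<epsilon> (k + 2))"
      using \<alpha>_square \<alpha>_\<epsilon> summable_iff_shift[of "\<lambda>k. (\<alpha> (Suc k))\<^sup>2" 1]
        summable_iff_shift[of "\<lambda>k. \<alpha> (Suc k) * \<epsilon> (Suc k)" 1] by simp_all
    show "x (k + 2) \<in> product_set Xi" for k
      using x_feasible[of "k + 1"] by simp
    fix i k
    show "x (Suc k + 2) $ i = closest_point (Xi i) (x (k + 2) $ i - \<alpha> (k + 2)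
        / max c (Max (range (\<lambda>i. norm (direction a (g i (k + 2)) (x (k + 2)) (v (k + 2)) i))))
        * (g i (k + 2) + disagreement a (x (k + 2)) i + disagreement a (v (k + 2)) i))"
      using x_step[of "k + 2" i] \<delta>_D[of "k + 2" i] by simp
    show "v (Suc k + 2) $ i = v (k + 2) $ i + \<alpha> (k + 2)
        / max c (Max (range (\<lambda>i. norm (direction a (g i (k + 2)) (x (k + 2)) (v (k + 2)) i))))
        * disagreement a (x (k + 2)) i"
      using v_step[of "k + 2" i] \<delta>_D[of "k + 2" i] by simp
    show "g i (k + 2) \<in> eps_subdifferential (f i) (\<epsilon> (k + 2)) (x (k + 2) $ i)"
      by (intro g_subgrad) simp
  qed (use f_convex X_closed X_convex graph conn saddle c_pos \<alpha>_pos \<epsilon>_pos not_summable in auto)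
  have optimum: "separable_sum f xs = fstar"
    using saddle_value[of fstar] fstar_lower Xstar_nonempty by (auto simp: X_def Xstar_def)
  have "convergent (\<lambda>k. norm ((x (k + 2), v (k + 2)) - (xs, vs)))"
    using convergent_z_dist unfolding z_dist_def[abs_def] .
  \<comment> \<open>Both shifted sequences converge exactly when the unshifted one does.\<close>
  then have distance: "convergent (\<lambda>k. norm ((x (k + 1), v (k + 1)) - (xs, vs)))"
    using convergent_ignore_initial_segment[of "\<lambda>k. norm ((x k, v k) - (xs, vs))" 1]
      convergent_ignore_initial_segment[of "\<lambda>k. norm ((x k, v k) - (xs, vs))" 2]
    by blast
  have agreement: "(\<lambda>k. x k $ i - x k $ j) \<longlonglongrightarrow> 0" for i j
    using LIMSEQ_offset[OF consensus] .
  have objective: "(\<lambda>k. separable_sum f (x k)) \<longlonglongrightarrow> separable_sum f xs"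
    using LIMSEQ_offset[OF separable_sum_tendsto] .
  have cluster: "\<exists>xbar vbar. cluster_point (\<lambda>k. (x k, v k)) (xbar, vbar) \<and> (\<exists>y\<in>Xstar. xbar = (\<chi> i. y))"
  proof -
    obtain s xbar vbar where s: "strict_mono s"
      and lim: "(\<lambda>k. (x (s k + 2), v (s k + 2))) \<longlonglongrightarrow> (xbar, vbar)"
      using convergent_subsequence[of "\<lambda>k. k"] by blast
    have "cluster_point (\<lambda>k. (x k, v k)) (xbar, vbar)"
      unfolding cluster_point_def using s lim
      by (intro exI[of _ "\<lambda>k. s k + 2"]) (simp add: o_def strict_mono_def)
    moreover obtain y where "xbar = (\<chi> i. y)" "y \<in> (\<Inter>i. Xi i)"
      "(\<Sum>i\<in>UNIV. f i y) = separable_sum f xs"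
      using cluster_consensus[OF s tendsto_fst[OF lim, unfolded fst_conv]] by blast
    then have "xbar = (\<chi> i. y)" "y \<in> Xstar"
      using optimum by (simp_all add: Xstar_def X_def)
    ultimately show ?thesis by blast
  qed
  have limit: "(\<lambda>k. x k $ i) \<longlonglongrightarrow> y" if "Xstar = {y}" for y i
  proof -
    have "(\<lambda>k. x (k + 2) $ i) \<longlonglongrightarrow> y"
    proof (rule tendsto_unique_minimizer)
      fix y' assume "y' \<in> (\<Inter>i. Xi i)" "(\<Sum>i\<in>UNIV. f i y') = separable_sum f xs"
      then have "y' \<in> Xstar"
        using optimum by (simp add: Xstar_def X_def)
      with that show "y' = y" by simp
    qed
    then show ?thesis by (rule LIMSEQ_offset)
  qed
  show ?thesis
    by (intro conjI allI impI distance agreement objective optimum cluster limit)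
qed

end
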